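(* Let $\mathcal{B}$ be the braiding matrix on $V_{2n}$ for the fundamental representation of $B_n$, with unknown coefficients $\beta_{a,2n-a}^{2n-b,b}$. Then for any $a=0,1,\dots,2n-1$ and $a<b\le 2n$, $$\beta_{a,2n-a}^{2n-b,b}=\begin{cases}(q^{1/2}-q^{-1/2})\,q^{-\frac12(a-b)},&(a-n)(b-n)>0,\\[2pt](q^{1/2}-q^{-1/2})\,q^{-\frac12(a-b+\frac12)},&(a-n)(b-n)=0,\\[2pt](q^{1/2}-q^{-1/2})\,q^{-\frac12(a-b+1)}+\delta_a^{2n-b}(q^{-1/2}-q^{1/2}),&(a-n)(b-n)<0.\end{cases}$$
   Context: Let $n\ge1$. Scalars are in $\mathbb{C}(t)$, $t$ an indeterminate, $q=t^4$, $q^{k/4}=t^k$. $V_{2n}$ is the vector space with basis $\mathcal{J}_{a,2n-a}$, $0\le a\le 2n$. The braiding matrix is an invertible linear map $\mathcal{B}:V_{2n}\to V_{2n}$ with entries $\mathcal{B}\mathcal{J}_{a,2n-a}=\sum_b\mathcal{B}_{a,2n-a}^{b,2n-b}\mathcal{J}_{b,2n-b}$, of the form $$\mathcal{B}\mathcal{J}_{a,2n-a}=\epsilon_a\mathcal{J}_{2n-a,a}+\sum_{b=a+1}^{2n}\beta_{a,2n-a}^{2n-b,b}\mathcal{J}_{2n-b,b},\qquad \epsilon_n=1,\ \epsilon_a=q^{1/2}\ (a\neq n),$$ and satisfying on $V_{2n}$ the relation $$\mathcal{B}_{a,2n-a}^{b,2n-b}-(\mathcal{B}^{-1})_{a,2n-a}^{b,2n-b}=(q^{1/2}-q^{-1/2})\left(\mathcal{M}_{a,2n-a}\mathcal{M}^{b,2n-b}-\delta_a^b\right)\quad(0\le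 a,b\le 2n),$$ where the fusion matrix is $\mathcal{M}_{a,2n-a}=\mathcal{M}^{a,2n-a}=q^{\frac12(n-a-\frac12)}$ for $0\le a<n$, $=1$ for $a=n$, $=q^{\frac12(n-a+\frac12)}$ for $n<a\le 2n$. *)

theory Defs
  imports "HOL-Computational_Algebra.Computational_Algebra"
begin

type_synonym scalar = "complex poly fract"

definition t_var :: scalar where
  "t_var = Fract [:0, 1:] 1"

text \<open>
  \<open>q_pow r\<close> is the power of \<open>q = t^4\<close> with exponent \<open>r\<close>, under the convention that \<open>t\<close> is the
  chosen fourth root of \<open>q\<close>. It is meaningful only for \<open>4 * r\<close> an integer (see
  \<open>q_pow_quarter\<close>); all exponents used are of this form.
\<close>

definition q_pow :: "rat \<Rightarrow> scalar" where
  "q_pow r = t_var powi \<lfloor>4 * r\<rfloor>"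

lemma q_pow_quarter: "q_pow (of_int k / 4) = t_var powi k"
  by (simp add: q_pow_def)

lemma q_pow_one: "q_pow 1 = t_var ^ 4"
  by (simp add: q_pow_def)

text \<open>
  Each index pair has entries summing to \<open>2 * n\<close>, so only its first entry is recorded: the basis
  vector with index pair \<open>(a, 2n - a)\<close> is \<open>J a\<close>, and a coefficient with lower pair \<open>(a, 2n - a)\<close>
  and upper pair \<open>(c, 2n - c)\<close> takes the arguments \<open>a c\<close> in this order.
  The fusion matrix has equal entries with lowered and with raised indices.
\<close>

definition fusion :: "nat \<Rightarrow> nat \<Rightarrow> scalar" where
  "fusion n a =
     (if a < n then q_pow (1/2 * (of_nat n - of_nat a - 1/2))
      else if a = n then 1
      else q_pow (1/2 * (of_nat n - of_nat a + 1/2)))"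

definition braid_eps :: "nat \<Rightarrow> nat \<Rightarrow> scalar" where
  "braid_eps n a = (if a = n then 1 else q_pow (1/2))"

definition entry ::
  "(scalar \<Rightarrow> 'v \<Rightarrow> 'v) \<Rightarrow> nat \<Rightarrow> (nat \<Rightarrow> 'v) \<Rightarrow> ('v::ab_group_add \<Rightarrow> 'v) \<Rightarrow> nat \<Rightarrow> nat \<Rightarrow> scalar"
where
  "entry scale n J F a c = module.representation scale (J ` {0..2*n}) (F (J a)) (J c)"

end

theory Submission
  imports Defs
begin

text \<open>
  The braiding matrix is supported on the entries \<open>(a, c)\<close> with \<open>a + c \<le> 2n\<close>, with invertible
  entries on the antidiagonal \<open>a + c = 2n\<close>, so its inverse is supported on \<open>a + c \<ge> 2n\<close>. Strictly
  above the antidiagonal the inverse drops out of the skein relation, which then gives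
  \<open>\<beta>\<close> directly in terms of the fusion matrix.
\<close>

context vector_space
begin

text \<open>Coordinates over \<open>T\<close>, extended by zero, are the coordinates over
  \<open>S\<close>. This turns a span membership into a vanishing matrix entry.\<close>

lemma representation_span_subset_eq_0:
  assumes "independent S" "T \<subseteq> S" "v \<in> span T" "x \<notin> T"
  shows "representation S v x = 0"
  using assms representation_extend[of S v T] representation_ne_zero[of T v x] by metis

text \<open>Back substitution: the equation for \<open>f (N - a)\<close> has leading term a nonzero
  multiple of \<open>J a\<close>, and its other terms involve only \<open>J\<close> of smaller
  index. With \<open>f\<close> the composite of \<open>B\<close> and \<open>J\<close>, this bounds
  the support of the inverse.\<close>

lemma span_image_antitriangular:
  fixes N :: nat
  assumes f: "\<And>a. a \<le> N \<Longrightarrow> f a = e a *s J (N - a) + (\<Sum>b=a+1..N. \<beta> a (N - b) *s J (N - b))"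
    and e: "\<And>a. a \<le> N \<Longrightarrow> e a \<noteq> 0"
    and "a \<le> N"
  shows "J a \<in> span (f ` {N - a..N})"
  using \<open>a \<le> N\<close>
proof (induction a rule: less_induct)
  case (less a)
  define W where "W = span (f ` {N - a..N})"
  \<comment> \<open>Here \<open>N - b < a\<close>, and the induction hypothesis uses only
    \<open>f\<close> on \<open>{b..N}\<close>, a subset of \<open>{N - a..N}\<close>.\<close>
  have "J (N - b) \<in> W" if "b \<in> {N - a + 1..N}" for b
    unfolding W_def
    using less.IH[of "N - b"] less.prems that
      span_mono[of "f ` {N - (N - b)..N}" "f ` {N - a..N}"] by fastforce
  then have "f (N - a) - (\<Sum>b=N-a+1..N. \<beta> (N - a) (N - b) *s J (N - b)) \<in> W"
    unfolding W_def by (intro span_diff span_sum span_scale) (auto intro: span_base)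
  moreover have "f (N - a) - (\<Sum>b=N-a+1..N. \<beta> (N - a) (N - b) *s J (N - b)) = e (N - a) *s J a"
    using f[of "N - a"] less.prems by simp
  ultimately have "inverse (e (N - a)) *s (e (N - a) *s J a) \<in> W"
    unfolding W_def by (metis span_scale)
  then show ?case
    using e[of "N - a"] by (simp add: W_def)
qed

lemma representation_antitriangular:
  fixes N :: nat
  assumes "inj_on J {0..N}" "independent (J ` {0..N})" "a < b" "b \<le> N"
  shows "representation (J ` {0..N})
      (e *s J (N - a) + (\<Sum>b=a+1..N. \<beta> (N - b) *s J (N - b))) (J (N - b)) = \<beta> (N - b)"
proof -
  \<comment> \<open>Truncated subtraction keeps \<open>N - k\<close> in \<open>{0..N}\<close> for
    every \<open>k\<close>.\<close>
  have S: "J (N - k) \<in> span (J ` {0..N})" for k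
    by (intro span_base) auto
  have J_eq: "J (N - k) = J (N - b) \<longleftrightarrow> k = b" if "k \<le> N" for k
    using inj_on_eq_iff[OF assms(1), of "N - k" "N - b"] that assms(4) by auto
  have rep: "representation (J ` {0..N}) (J (N - k)) (J (N - b)) = (if k = b then 1 else 0)"
    if "k \<le> N" for k
    using assms(2) J_eq[OF that] by (subst representation_basis) auto
  have "representation (J ` {0..N})
      (e *s J (N - a) + (\<Sum>b=a+1..N. \<beta> (N - b) *s J (N - b))) (J (N - b))
    = e * (if a = b then 1 else 0) + (\<Sum>k=a+1..N. \<beta> (N - k) * (if k = b then 1 else 0))"
    using assms(2-4) S rep
    by (simp add: representation_add representation_sum representation_scale span_scale span_sum)
  also have "\<dots> = \<beta> (N - b)"
    using assms(3,4) by (simp add: if_distrib[of "(*) _"] cong: if_cong)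
  finally show ?thesis .
qed

end

lemma t_var_nonzero: "t_var \<noteq> 0"
  by (simp add: t_var_def Zero_fract_def eq_fract)

lemma q_pow_eqI: "4 * r = of_int k \<Longrightarrow> q_pow r = t_var powi k"
  by (simp add: q_pow_def)

text \<open>Because of the floor, \<open>q_pow\<close> is not additive on arbitrary rationals;
  integer powers of \<open>t_var\<close> are, so products are computed there.\<close>

lemma fusion_powi:
  "fusion n a = t_var powi
     (if a < n then 2 * (int n - int a) - 1 else if a = n then 0 else 2 * (int n - int a) + 1)"
  unfolding fusion_def by (auto intro!: q_pow_eqI)

text \<open>Since \<open>n - (2*n - b) = b - n\<close>, the main parts of the two exponents of
  \<open>t_var\<close> add up to \<open>2 * (b - a)\<close>. The shifts by 1 cancel if
  \<open>a\<close> and \<open>b\<close> lie on the same side of \<open>n\<close>, leave -1 if one of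
  them equals \<open>n\<close>, and add up to -2 if \<open>a < n < b\<close>.\<close>

lemma fusion_mult_reflected:
  assumes "a < b" "b \<le> 2 * n"
  shows "fusion n a * fusion n (2*n - b) =
    (if (int a - int n) * (int b - int n) > 0 then q_pow (- (1/2) * (of_nat a - of_nat b))
     else if (int a - int n) * (int b - int n) = 0
       then q_pow (- (1/2) * (of_nat a - of_nat b + 1/2))
     else q_pow (- (1/2) * (of_nat a - of_nat b + 1)))"
proof -
  have q: "q_pow (- (1/2) * (of_nat a - of_nat b)) = t_var powi (2 * (int b - int a))"
    "q_pow (- (1/2) * (of_nat a - of_nat b + 1/2)) = t_var powi (2 * (int b - int a) - 1)"
    "q_pow (- (1/2) * (of_nat a - of_nat b + 1)) = t_var powi (2 * (int b - int a) - 2)"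
    by (auto intro!: q_pow_eqI simp: field_simps)
  show ?thesis
    unfolding q fusion_powi power_int_add[OF disjI1[OF t_var_nonzero], symmetric]
    using assms
    by (auto simp: zero_less_mult_iff of_nat_diff intro!: arg_cong[where f = "power_int t_var"])
qed

theorem theorem4p13:
  fixes n :: nat
    and scale :: "scalar \<Rightarrow> 'v::ab_group_add \<Rightarrow> 'v"
    and J :: "nat \<Rightarrow> 'v"
    and B :: "'v \<Rightarrow> 'v"
    and \<beta> :: "nat \<Rightarrow> nat \<Rightarrow> scalar"
    and a b :: nat
  assumes "n \<ge> 1"
    and "vector_space scale"
    and "inj_on J {0..2*n}"
    and "\<not> module.dependent scale (J ` {0..2*n})"
    and "module.span scale (J ` {0..2*n}) = UNIV"
    and "Vector_Spaces.linear scale scale B"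
    and "bij B"
    and "\<And>a. a \<le> 2*n \<Longrightarrow>
           B (J a) = scale (braid_eps n a) (J (2*n - a))
                     + (\<Sum>b=a+1..2*n. scale (\<beta> a (2*n - b)) (J (2*n - b)))"
    and "\<And>a b. a \<le> 2*n \<Longrightarrow> b \<le> 2*n \<Longrightarrow>
           entry scale n J B a b - entry scale n J (inv B) a b
             = (q_pow (1/2) - q_pow (-1/2)) * (fusion n a * fusion n b - (if a = b then 1 else 0))"
    and "a \<le> 2*n - 1" and "a < b" and "b \<le> 2*n"
  shows "\<beta> a (2*n - b) =
    (if (int a - int n) * (int b - int n) > 0 then
       (q_pow (1/2) - q_pow (-1/2)) * q_pow (- (1/2) * (of_nat a - of_nat b))
     else if (int a - int n) * (int b - int n) = 0 then
       (q_pow (1/2) - q_pow (-1/2)) * q_pow (- (1/2) * (of_nat a - of_nat b + 1/2))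
     else
       (q_pow (1/2) - q_pow (-1/2)) * q_pow (- (1/2) * (of_nat a - of_nat b + 1))
         + (if a = 2*n - b then 1 else 0) * (q_pow (-1/2) - q_pow (1/2)))"
proof -
  interpret vector_space scale by fact
  note J_inj = assms(3) and J_indep = assms(4) and B_J = assms(8) and skein = assms(9)
  interpret B: Vector_Spaces.linear scale scale B by fact
  have eps: "braid_eps n k \<noteq> 0" for k
    by (simp add: braid_eps_def q_pow_def t_var_nonzero)
  have "entry scale n J B a (2*n - b) = \<beta> a (2*n - b)"
    using representation_antitriangular[OF J_inj J_indep] B_J[of a] assms(10-12)
    by (simp add: entry_def)
  moreover have "entry scale n J (inv B) a (2*n - b) = 0"
  proof -
    \<comment> \<open>Applying \<open>inv B\<close> to this membership gives the support of row
      \<open>a\<close> of the inverse; column \<open>2*n - b\<close> lies outside it because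
      \<open>a < b\<close>.\<close>
    have "J a \<in> span ((\<lambda>k. B (J k)) ` {2*n - a..2*n})"
      using B_J eps assms(10) by (intro span_image_antitriangular[where N = "2*n"]) auto
    also have "\<dots> = B ` span (J ` {2*n - a..2*n})"
      by (simp add: B.span_image flip: image_image)
    finally have "inv B (J a) \<in> span (J ` {2*n - a..2*n})"
      using bij_is_inj[OF \<open>bij B\<close>] by (auto simp: inv_f_f)
    moreover have "J (2*n - b) \<notin> J ` {2*n - a..2*n}"
      using inj_on_image_mem_iff[OF J_inj, of "2*n - b" "{2*n - a..2*n}"] assms(10-12) by auto
    ultimately show ?thesis
      unfolding entry_def
      by (intro representation_span_subset_eq_0[OF J_indep, of "J ` {2*n - a..2*n}"]) auto
  qed
  ultimately have "\<beta> a (2*n - b)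
    = (q_pow (1/2) - q_pow (-1/2)) * (fusion n a * fusion n (2*n - b) - (if a = 2*n - b then 1 else 0))"
    using skein[of a "2*n - b"] assms(10) by simp
  \<comment> \<open>With \<open>a < b\<close> this forces \<open>a < n < b\<close>, so the Kronecker
    delta survives only in the third case.\<close>
  moreover have "a = 2*n - b \<Longrightarrow> (int a - int n) * (int b - int n) < 0"
    using assms(11,12) by (auto simp: mult_less_0_iff)
  ultimately show ?thesis
    unfolding fusion_mult_reflected[OF assms(11,12)] by (auto simp: right_diff_distrib)
qed

end
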